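(* Let $\Omega\subset\mathbb{R}^2$ be the (flat) midplane of a plate, let $\mathbf{y}=(y_k)_{k=1}^3:\Omega\to\mathbb{R}^3$ be a sufficiently smooth orientable deformation, and let $g=\mathrm{I}[\mathbf{y}]$ and $\mathrm{II}[\mathbf{y}]$ be the first and second fundamental forms of $\mathbf{y}(\Omega)$, where $g:\Omega\to\mathbb{R}^{2\times2}$ is symmetric uniformly positive definite. Then there exist functions $f_1,f_2:\Omega\to\mathbb{R}_{\ge 0}$ depending only on $g$ and its derivatives such that $$\big|g^{-\frac12}\,D^2\mathbf{y}\,g^{-\frac12}\big|^2=\big|g^{-\frac12}\,\mathrm{II}[\mathbf{y}]\,g^{-\frac12}\big|^2+f_1$$ and $$\big|\mathrm{tr}\big(g^{-\frac12}\,D^2\mathbf{y}\,g^{-\frac12}\big)\big|^2=\mathrm{tr}\big(g^{-\frac12}\,\mathrm{II}[\mathbf{y}]\,g^{-\frac12}\big)^2+f_2 .$$ Precisely, writing $a:=g^{-\frac12}$ and $\Gamma_{ij}^l$ for the Christoffel symbols of $\mathbf{y}(\Omega)$, these functions are $$f_1=\sum_{i,j=1}^2\ \sum_{l_1,l_2=1}^2 g_{l_1l_2}\sum_{m_1,m_2,n_1,n_2=1}^2 a_{im_1}a_{im_2}\Gamma_{m_1n_1}^{l_1}\Gamma_{m_2n_2}^{l_2}a_{n_1j}a_{n_2j},$$ $$f_2=\sum_{l_1,l_2=1}^2 g_{l_1l_2}\sum_{i_1,i_2,m_1,m_2,n_1,n_2=1}^2 a_{i_1m_1}a_{i_2m_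2}\Gamma_{m_1n_1}^{l_1}\Gamma_{m_2n_2}^{l_2}a_{n_1i_1}a_{n_2i_2}.$$
   Context: Notation. $\nabla\mathbf{y}\in\mathbb{R}^{3\times2}$ is the matrix $(\nabla\mathbf{y})_{ij}=\partial_j y_i$. The first fundamental form is $\mathrm{I}[\mathbf{y}]=\nabla\mathbf{y}^T\nabla\mathbf{y}$, so $g_{ij}=\partial_i\mathbf{y}\cdot\partial_j\mathbf{y}$. The unit normal to $\mathbf{y}(\Omega)$ is $\boldsymbol{\nu}=\dfrac{\partial_1\mathbf{y}\times\partial_2\mathbf{y}}{|\partial_1\mathbf{y}\times\partial_2\mathbf{y}|}$, and the second fundamental form is $\mathrm{II}[\mathbf{y}]=-\nabla\boldsymbol{\nu}^T\nabla\mathbf{y}=(\partial_{ij}\mathbf{y}\cdot\boldsymbol{\nu})_{i,j=1}^2$. The matrix $g^{-1/2}$ is the inverse of the square root of $g$ (taken pointwise). For a matrix $A$, $|A|=\big(\sum_{i,j}A_{ij}^2\big)^{1/2}$ is the Frobenius norm; for a vector, $|\cdot|$ is the Euclidean norm. $D^2y_k=(\partial_{ij}y_k)_{i,j=1}^2$ is the Hessian of the $k$-th component, and $D^2\mathbf{y}=(D^2y_k)_{k=1}^3\in\mathbb{R}^{3\times2\times2}$. Conventions for such third-order tensors: $g^{-1/2}D^2\mathbf{y}\,g^{-1/2}:=\big(g^{-1/2}D^2y_k\,g^{-1/2}\big)_{k=1}^3$, with $$\big|g^{-1/2}D^2\mathbf{y}\,g^{-1/2}\big|=\Big(\sum_{k=1}^3\big|g^{-1/2}D^2y_k\,g^{-1/2}\big|^2\Big)^{1/2},\qquad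 \mathrm{tr}\big(g^{-1/2}D^2\mathbf{y}\,g^{-1/2}\big)=\Big(\mathrm{tr}\big(g^{-1/2}D^2y_k\,g^{-1/2}\big)\Big)_{k=1}^3\in\mathbb{R}^3 .$$ For the matrix $\mathrm{II}[\mathbf{y}]$, $\mathrm{tr}(\cdot)^2$ means the square of the (scalar) trace. The Christoffel symbols $\Gamma_{ij}^l$ of $\mathbf{y}(\Omega)$ are the coefficients in the unique expansion $\partial_{ij}\mathbf{y}=\sum_{l=1}^2\Gamma_{ij}^l\,\partial_l\mathbf{y}+\mathrm{II}_{ij}[\mathbf{y}]\,\boldsymbol{\nu}$, $i,j\in\{1,2\}$; they are intrinsic, i.e. they can be computed from the coefficients $g_{ij}$ of $g$ and their derivatives and do not depend explicitly on $\mathbf{y}$. *)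

theory Defs
  imports "HOL-Analysis.Analysis"
begin

definition partial_deriv :: "'n::finite \<Rightarrow> (real^'n \<Rightarrow> 'b::real_normed_vector) \<Rightarrow> real^'n \<Rightarrow> 'b"
  where "partial_deriv i f x = frechet_derivative f (at x) (axis i 1)"

(* The derivatives are taken at x, not within S; this is the usual C^k class when S is open. *)
primrec Ck_on :: "nat \<Rightarrow> (real^'n::finite \<Rightarrow> 'b::real_normed_vector) \<Rightarrow> (real^'n) set \<Rightarrow> bool"
  where
    "Ck_on 0 f S \<longleftrightarrow> continuous_on S f"
  | "Ck_on (Suc k) f S \<longleftrightarrow>
       (\<forall>x\<in>S. f differentiable (at x)) \<and> (\<forall>i. Ck_on k (partial_deriv i f) S)"

definition uniformly_spd_on :: "'a set \<Rightarrow> ('a \<Rightarrow> real^'n::finite^'n) \<Rightarrow> bool"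
  where "uniformly_spd_on S g \<longleftrightarrow>
    (\<forall>x\<in>S. transpose (g x) = g x) \<and>
    (\<exists>c>0. \<forall>x\<in>S. \<forall>v. c * (v \<bullet> v) \<le> v \<bullet> (g x *v v))"

definition matrix_sqrt :: "real^'n::finite^'n \<Rightarrow> real^'n^'n"
  where "matrix_sqrt A =
    (THE S. transpose S = S \<and> (\<forall>v. 0 \<le> v \<bullet> (S *v v)) \<and> S ** S = A)"

definition inv_sqrt :: "real^'n::finite^'n \<Rightarrow> real^'n^'n"
  where "inv_sqrt A = matrix_inv (matrix_sqrt A)"

(* For a map from real^2 to real^3, jacobian y (at x) $ k $ j is the j-th partial derivative
   of the k-th component, so it is the 3 x 2 gradient matrix. *)

definition first_form :: "(real^2 \<Rightarrow> real^3) \<Rightarrow> real^2 \<Rightarrow> real^2^2"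
  where "first_form y x = transpose (jacobian y (at x)) ** jacobian y (at x)"

definition unit_normal :: "(real^2 \<Rightarrow> real^3) \<Rightarrow> real^2 \<Rightarrow> real^3"
  where "unit_normal y x =
    (let n = cross3 (partial_deriv 1 y x) (partial_deriv 2 y x) in n /\<^sub>R norm n)"

definition second_form :: "(real^2 \<Rightarrow> real^3) \<Rightarrow> real^2 \<Rightarrow> real^2^2"
  where "second_form y x = - (transpose (jacobian (unit_normal y) (at x)) ** jacobian y (at x))"

definition christoffel :: "(real^2 \<Rightarrow> real^3) \<Rightarrow> real^2 \<Rightarrow> 2 \<Rightarrow> 2 \<Rightarrow> 2 \<Rightarrow> real"
  where \<comment> \<open>The upper index comes first: \<open>christoffel y x l i j\<close> is \<open>\<Gamma>\<^bsub>ij\<^esub>\<^bsup>l\<^esup>\<close> at \<open>x\<close>.\<close>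
  "christoffel y x =
    (THE \<Gamma>. \<forall>i j. partial_deriv i (partial_deriv j y) x =
       (\<Sum>l\<in>UNIV. \<Gamma> l i j *\<^sub>R partial_deriv l y x) + second_form y x $ i $ j *\<^sub>R unit_normal y x)"

definition hessian :: "(real^'n::finite \<Rightarrow> real) \<Rightarrow> real^'n \<Rightarrow> real^'n^'n"
  where "hessian f x = (\<chi> i j. partial_deriv i (partial_deriv j f) x)"

(* Third-order tensors are vectors of matrices. The library norms on real^2^2 and on real^2^2^3
   are Euclidean in all entries, i.e. the Frobenius norms. *)

definition hessian_tensor :: "(real^'n::finite \<Rightarrow> real^'m::finite) \<Rightarrow> real^'n \<Rightarrow> real^'n^'n^'m"
  where "hessian_tensor y x = (\<chi> k. hessian (\<lambda>z. y z $ k) x)"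

definition tensor_conj :: "real^'n::finite^'n \<Rightarrow> real^'n^'n^'m::finite \<Rightarrow> real^'n^'n^'m"
  where "tensor_conj a T = (\<chi> k. a ** T $ k ** a)"

definition tensor_trace :: "real^'n::finite^'n^'m::finite \<Rightarrow> real^'m"
  where "tensor_trace T = (\<chi> k. trace (T $ k))"

end

theory Submission
  imports Defs
begin

text \<open>
  The Gauss formula \<open>\<partial>\<^sub>i\<^sub>jy = \<Gamma>\<^sub>i\<^sub>j\<^sup>l \<partial>\<^sub>ly + II\<^sub>i\<^sub>j \<nu>\<close> splits the Hessian
  tensor into a tangential part and a normal part. Conjugation by \<open>g\<^sup>-\<^sup>1\<^sup>/\<^sup>2\<close> and the trace act linearly
  on the indices \<open>i, j\<close> and do not touch the component index \<open>k\<close> of \<open>\<real>\<^sup>3\<close>, so both tensors in the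
  theorem again have the form \<open>\<Sum>\<^sub>l \<partial>\<^sub>ly \<otimes> X\<^sub>l + \<nu> \<otimes> Y\<close>, with \<open>Y\<close> built from \<open>II\<close>
  and \<open>X\<^sub>l\<close> from \<open>\<Gamma>\<^sup>l\<close>. As \<open>\<nu>\<close> is a unit vector orthogonal to the tangent plane, Pythagoras gives
  \<open>\<bar>Y\<bar>\<^sup>2 + \<Sum> g\<^sub>l\<^sub>m (X\<^sub>l \<bullet> X\<^sub>m)\<close> for the squared norm (\<open>norm_tensor_pythagoras\<close>).
  The second summand is \<open>f\<^sub>1\<close> or \<open>f\<^sub>2\<close>, depending on whether \<open>X\<^sub>l\<close> is a matrix or its trace. It is the
  squared norm of the tangential part, hence nonnegative, and multiplying out the matrix products
  gives the explicit sums.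

  The dependence on \<open>g\<close> and \<open>\<partial>g\<close> alone is the classical formula for the Christoffel symbols
  (\<open>christoffel_eq_metric_christoffel\<close>). It rests on the symmetry of second partial derivatives
  (\<open>partial_deriv_commute\<close>), which makes the three product rules for \<open>\<partial>\<^sub>ig\<^sub>j\<^sub>m\<close>, \<open>\<partial>\<^sub>jg\<^sub>i\<^sub>m\<close> and
  \<open>\<partial>\<^sub>mg\<^sub>i\<^sub>j\<close> solvable for \<open>\<partial>\<^sub>i\<^sub>jy \<bullet> \<partial>\<^sub>my\<close>. The matrix \<open>g\<^sup>-\<^sup>1\<^sup>/\<^sup>2\<close> enters as a fixed
  matrix determined by \<open>g\<close>; positive definiteness is used through the invertibility of \<open>g\<close>.
\<close>

section \<open>Partial derivatives and their symmetry\<close>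

lemma partial_deriv_eqI:
  assumes "(f has_derivative f') (at x)"
  shows "partial_deriv i f x = f' (axis i 1)"
  using frechet_derivative_at[OF assms] by (simp add: partial_deriv_def)

lemma has_derivative_frechet_derivative:
  assumes "f differentiable (at x)"
  shows "(f has_derivative frechet_derivative f (at x)) (at x)"
  using assms by (simp add: frechet_derivative_works)

lemma partial_deriv_bounded_linear:
  assumes "bounded_linear L" "f differentiable (at x)"
  shows "partial_deriv i (\<lambda>z. L (f z)) x = L (partial_deriv i f x)"
  using partial_deriv_eqI[OF bounded_linear.has_derivative[OF assms(1) has_derivative_frechet_derivative[OF assms(2)]]]
  by (simp add: partial_deriv_def)

lemma partial_deriv_cong_open:
  assumes "open S" "x \<in> S" "\<And>z. z \<in> S \<Longrightarrow> f z = h z" "f differentiable (at x)"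
  shows "partial_deriv i f x = partial_deriv i h x"
  using frechet_derivative_transform_within_open[OF assms(4,1,2,3)] by (simp add: partial_deriv_def)

lemma partial_deriv_inner:
  assumes "f differentiable (at x)" "h differentiable (at x)"
  shows "partial_deriv i (\<lambda>z. f z \<bullet> h z) x
    = partial_deriv i f x \<bullet> h x + f x \<bullet> partial_deriv i h x"
  using partial_deriv_eqI[OF has_derivative_inner[OF has_derivative_frechet_derivative has_derivative_frechet_derivative], OF assms]
  by (simp add: partial_deriv_def)

lemma differentiable_inner:
  fixes f h :: "'a::real_normed_vector \<Rightarrow> 'b::real_inner"
  assumes "f differentiable (at x)" "h differentiable (at x)"
  shows "(\<lambda>z. f z \<bullet> h z) differentiable (at x)"
  using assms has_derivative_inner unfolding differentiable_def by blast

text \<open>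
  Pairing with a fixed vector \<open>v\<close> makes the mean value theorem available for vector-valued maps.
\<close>

lemma DERIV_along_axis:
  fixes f :: "real^'n::finite \<Rightarrow> 'b::real_inner"
  assumes "f differentiable (at (p + t *\<^sub>R axis i 1))"
  shows "((\<lambda>s. f (p + s *\<^sub>R axis i 1) \<bullet> v) has_real_derivative
    partial_deriv i f (p + t *\<^sub>R axis i 1) \<bullet> v) (at t)"
proof -
  let ?x = "p + t *\<^sub>R axis i 1"
  let ?D = "frechet_derivative f (at ?x)"
  have D: "(f has_derivative ?D) (at ?x)"
    by (rule has_derivative_frechet_derivative[OF assms])
  have "((\<lambda>s. p + s *\<^sub>R axis i 1) has_derivative (\<lambda>s. s *\<^sub>R axis i 1)) (at t)"
    by (auto intro!: derivative_eq_intros)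
  from has_derivative_compose[OF this D]
  have "((\<lambda>s. f (p + s *\<^sub>R axis i 1) \<bullet> v) has_derivative (\<lambda>s. ?D (s *\<^sub>R axis i 1) \<bullet> v)) (at t)"
    by (rule has_derivative_inner_left)
  moreover have "?D (s *\<^sub>R axis i 1) = s *\<^sub>R ?D (axis i 1)" for s
    using has_derivative_linear[OF D] by (simp add: linear_cmul)
  ultimately show ?thesis
    by (simp add: has_field_derivative_def partial_deriv_def mult.commute[of _ "_ \<bullet> _"])
qed

text \<open>
  Two applications of the mean value theorem, the outer one in direction \<open>i\<close> to the increment of \<open>f\<close>
  in direction \<open>j\<close>. The left-hand side is symmetric in \<open>i\<close> and \<open>j\<close>, the right-hand side is not: this
  is what forces mixed derivatives to agree.
\<close>

lemma second_difference_mean_value: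
  fixes f :: "real^'n::finite \<Rightarrow> 'b::real_inner"
  assumes df: "\<And>z. z \<in> ball x r \<Longrightarrow> f differentiable (at z)"
    and ddf: "\<And>z. z \<in> ball x r \<Longrightarrow> partial_deriv i f differentiable (at z)"
    and h: "0 < h" "2 * h < r"
  shows "\<exists>\<xi>\<in>ball x r.
    (f (x + h *\<^sub>R axis i 1 + h *\<^sub>R axis j 1) - f (x + h *\<^sub>R axis i 1) - f (x + h *\<^sub>R axis j 1) + f x) \<bullet> v
      = h\<^sup>2 * (partial_deriv j (partial_deriv i f) \<xi> \<bullet> v)"
proof -
  let ?e = "\<lambda>i. axis i 1 :: real^'n"
  have near: "x + t *\<^sub>R ?e i + s *\<^sub>R ?e j \<in> ball x r" if "0 \<le> t" "t \<le> h" "0 \<le> s" "s \<le> h" for s t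
  proof -
    have "norm (t *\<^sub>R ?e i + s *\<^sub>R ?e j) \<le> t + s"
      using norm_triangle_ineq[of "t *\<^sub>R ?e i" "s *\<^sub>R ?e j"] that by simp
    moreover have "dist x (x + u) = norm u" for u :: "real^'n"
      by (simp add: dist_norm)
    ultimately show ?thesis
      using that h by (simp add: add.assoc)
  qed
  define \<phi> where "\<phi> t = f (x + t *\<^sub>R ?e i + h *\<^sub>R ?e j) \<bullet> v - f (x + t *\<^sub>R ?e i) \<bullet> v" for t
  have "DERIV \<phi> t :> partial_deriv i f (x + t *\<^sub>R ?e i + h *\<^sub>R ?e j) \<bullet> v - partial_deriv i f (x + t *\<^sub>R ?e i) \<bullet> v"
    if "0 \<le> t" "t \<le> h" for t
    unfolding \<phi>_def
    using DERIV_along_axis[of f "x + h *\<^sub>R ?e j" t i v] DERIV_along_axis[of f x t i v]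
      df[OF near[of t h]] df[OF near[of t 0]] that h
    by (intro DERIV_diff) (simp_all add: ac_simps)
  from MVT2[OF h(1) this] obtain t where t: "0 < t" "t < h" and
    phi: "\<phi> h - \<phi> 0 = h * (partial_deriv i f (x + t *\<^sub>R ?e i + h *\<^sub>R ?e j) \<bullet> v - partial_deriv i f (x + t *\<^sub>R ?e i) \<bullet> v)"
    by auto
  have "DERIV (\<lambda>s. partial_deriv i f (x + t *\<^sub>R ?e i + s *\<^sub>R ?e j) \<bullet> v) s
      :> partial_deriv j (partial_deriv i f) (x + t *\<^sub>R ?e i + s *\<^sub>R ?e j) \<bullet> v"
    if "0 \<le> s" "s \<le> h" for s
    by (rule DERIV_along_axis) (use ddf near t that in auto)
  from MVT2[OF h(1) this] obtain s where s: "0 < s" "s < h" and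
    psi: "partial_deriv i f (x + t *\<^sub>R ?e i + h *\<^sub>R ?e j) \<bullet> v - partial_deriv i f (x + t *\<^sub>R ?e i) \<bullet> v
       = h * (partial_deriv j (partial_deriv i f) (x + t *\<^sub>R ?e i + s *\<^sub>R ?e j) \<bullet> v)"
    by auto
  show ?thesis
  proof
    show "x + t *\<^sub>R ?e i + s *\<^sub>R ?e j \<in> ball x r" using near s t by simp
    show "(f (x + h *\<^sub>R ?e i + h *\<^sub>R ?e j) - f (x + h *\<^sub>R ?e i) - f (x + h *\<^sub>R ?e j) + f x) \<bullet> v
      = h\<^sup>2 * (partial_deriv j (partial_deriv i f) (x + t *\<^sub>R ?e i + s *\<^sub>R ?e j) \<bullet> v)"
      using phi unfolding psi
      by (simp add: \<phi>_def inner_diff_left inner_add_left power2_eq_square)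
  qed
qed

text \<open>
  Both mixed derivatives are limits of the same second difference quotient: by the mean value form it
  equals either derivative at some point near \<open>x\<close>, and both are continuous at \<open>x\<close>.
\<close>

lemma partial_deriv_commute:
  fixes f :: "real^'n::finite \<Rightarrow> 'b::real_inner"
  assumes S: "open S" "x \<in> S"
    and df: "\<And>z. z \<in> S \<Longrightarrow> f differentiable (at z)"
    and ddf: "\<And>k z. z \<in> S \<Longrightarrow> partial_deriv k f differentiable (at z)"
    and cont: "\<And>k l. continuous_on S (partial_deriv k (partial_deriv l f))"
  shows "partial_deriv i (partial_deriv j f) x = partial_deriv j (partial_deriv i f) x"
proof -
  let ?A = "partial_deriv j (partial_deriv i f)" and ?B = "partial_deriv i (partial_deriv j f)"
  \<comment> \<open>Testing against the difference itself turns the scalar identity into equality of vectors.\<close>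
  define v where "v = ?A x - ?B x"
  have lim: "((\<lambda>z. partial_deriv k (partial_deriv l f) z \<bullet> v) \<longlongrightarrow> partial_deriv k (partial_deriv l f) x \<bullet> v) (nhds x)" for k l
  proof -
    have "isCont (partial_deriv k (partial_deriv l f)) x"
      using cont S by (simp add: continuous_on_eq_continuous_at)
    then show ?thesis
      by (intro tendsto_inner tendsto_const) (simp add: isCont_def tendsto_at_iff_tendsto_nhds)
  qed
  have "?A x \<bullet> v = ?B x \<bullet> v"
  proof (rule ccontr)
    assume ne: "?A x \<bullet> v \<noteq> ?B x \<bullet> v"
    define e where "e = \<bar>?A x \<bullet> v - ?B x \<bullet> v\<bar> / 2"
    have e: "e > 0" using ne by (simp add: e_def)
    have "\<forall>\<^sub>F z in nhds x. dist (?A z \<bullet> v) (?A x \<bullet> v) < e \<and> dist (?B z \<bullet> v) (?B x \<bullet> v) < e \<and> z \<in> S"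
      using tendstoD[OF lim e] S by (intro eventually_conj eventually_nhds_in_open) auto
    then obtain r where r: "r > 0" and
      near: "\<And>z. z \<in> ball x r \<Longrightarrow> dist (?A z \<bullet> v) (?A x \<bullet> v) < e \<and> dist (?B z \<bullet> v) (?B x \<bullet> v) < e \<and> z \<in> S"
      unfolding eventually_nhds_metric by (auto simp: dist_commute)
    define h where "h = r / 3"
    have h: "0 < h" "2 * h < r" using r by (simp_all add: h_def)
    obtain \<xi> where \<xi>: "\<xi> \<in> ball x r" and
      1: "(f (x + h *\<^sub>R axis i 1 + h *\<^sub>R axis j 1) - f (x + h *\<^sub>R axis i 1) - f (x + h *\<^sub>R axis j 1) + f x) \<bullet> v
        = h\<^sup>2 * (?A \<xi> \<bullet> v)"
      using second_difference_mean_value[of x r f i h j v] df ddf near h by blast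
    obtain \<eta> where \<eta>: "\<eta> \<in> ball x r" and
      2: "(f (x + h *\<^sub>R axis j 1 + h *\<^sub>R axis i 1) - f (x + h *\<^sub>R axis j 1) - f (x + h *\<^sub>R axis i 1) + f x) \<bullet> v
        = h\<^sup>2 * (?B \<eta> \<bullet> v)"
      using second_difference_mean_value[of x r f j h i v] df ddf near h by blast
    have "x + h *\<^sub>R axis i 1 + h *\<^sub>R axis j 1 = x + h *\<^sub>R axis j 1 + h *\<^sub>R axis i 1"
      by (simp add: ac_simps)
    then have "h\<^sup>2 * (?A \<xi> \<bullet> v) = h\<^sup>2 * (?B \<eta> \<bullet> v)"
      unfolding 1[symmetric] 2[symmetric] by (simp add: algebra_simps)
    then have "?A \<xi> \<bullet> v = ?B \<eta> \<bullet> v" using h by simp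
    then have "\<bar>?A x \<bullet> v - ?B x \<bullet> v\<bar> < 2 * e"
      using near[OF \<xi>, THEN conjunct1] near[OF \<eta>, THEN conjunct2, THEN conjunct1]
      unfolding dist_real_def by linarith
    then show False by (simp add: e_def)
  qed
  then have "v \<bullet> v = 0" unfolding v_def[symmetric] by (simp add: v_def inner_diff_left)
  then show ?thesis by (simp add: v_def)
qed

section \<open>The Gauss formula\<close>

text \<open>
  The Christoffel symbols \<open>\<Gamma>\<^sub>i\<^sub>j\<^sup>l\<close> of the Levi-Civita connection of \<open>g\<close>, obtained by raising an index of
  the symbols of the first kind; \<open>dg k\<close> stands for \<open>\<partial>\<^sub>kg\<close> and the upper index comes first. The derivative of \<open>g\<close> is a separate argument so that the symbols
  visibly depend on pointwise values of \<open>g\<close> and \<open>\<partial>g\<close> only.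
\<close>

definition metric_christoffel :: "real^2^2 \<Rightarrow> (2 \<Rightarrow> real^2^2) \<Rightarrow> 2 \<Rightarrow> 2 \<Rightarrow> 2 \<Rightarrow> real"
  where "metric_christoffel g dg l i j =
    (matrix_inv g *v (\<chi> m. (dg i $ j $ m + dg j $ i $ m - dg m $ i $ j) / 2)) $ l"

lemma Ck_on_2D:
  assumes "Ck_on 2 y S"
  shows "\<And>z. z \<in> S \<Longrightarrow> y differentiable (at z)"
    "\<And>i z. z \<in> S \<Longrightarrow> partial_deriv i y differentiable (at z)"
    "\<And>i j. continuous_on S (partial_deriv i (partial_deriv j y))"
  using assms by (simp_all add: numeral_2_eq_2)

lemma first_form_nth: "first_form y x $ i $ j = partial_deriv i y x \<bullet> partial_deriv j y x"
  by (simp add: first_form_def matrix_matrix_mult_def transpose_def jacobian_def matrix_def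
      partial_deriv_def inner_vec_def)

lemma second_form_nth:
  "second_form y x $ i $ j = - (partial_deriv i (unit_normal y) x \<bullet> partial_deriv j y x)"
  by (simp add: second_form_def matrix_matrix_mult_def transpose_def jacobian_def matrix_def
      partial_deriv_def inner_vec_def)

lemma hessian_tensor_nth:
  fixes y :: "real^'n::finite \<Rightarrow> real^'m::finite"
  assumes S: "open S" "x \<in> S" and C: "Ck_on 2 y S"
  shows "hessian_tensor y x $ k $ i $ j = partial_deriv i (partial_deriv j y) x $ k"
proof -
  \<comment> \<open>The inner derivative commutes with taking components only where \<open>y\<close> is differentiable, so openness
    of \<open>S\<close> is needed to differentiate that identity.\<close>
  have "partial_deriv i (partial_deriv j (\<lambda>z. y z $ k)) x = partial_deriv i (\<lambda>z. partial_deriv j y z $ k) x"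
  proof (rule partial_deriv_cong_open[OF S, symmetric])
    show "partial_deriv j y z $ k = partial_deriv j (\<lambda>z. y z $ k) z" if "z \<in> S" for z
      using partial_deriv_bounded_linear[OF bounded_linear_vec_nth Ck_on_2D(1)[OF C that]] by simp
    show "(\<lambda>z. partial_deriv j y z $ k) differentiable (at x)"
      using Ck_on_2D(2)[OF C S(2)] bounded_linear.has_derivative[OF bounded_linear_vec_nth]
      unfolding differentiable_def by blast
  qed
  then show ?thesis
    using partial_deriv_bounded_linear[OF bounded_linear_vec_nth Ck_on_2D(2)[OF C S(2)]]
    by (simp add: hessian_tensor_def hessian_def)
qed

lemma partial_deriv_first_form:
  assumes "\<And>i. partial_deriv i y differentiable (at x)"
  shows "partial_deriv k (first_form y) x $ i $ j
    = partial_deriv k (partial_deriv i y) x \<bullet> partial_deriv j y x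
    + partial_deriv i y x \<bullet> partial_deriv k (partial_deriv j y) x"
proof -
  \<comment> \<open>Expanding in matrix units gives differentiability of the matrix-valued map from its entries.\<close>
  have eq: "first_form y = (\<lambda>z. \<Sum>i\<in>UNIV. \<Sum>j\<in>UNIV. (partial_deriv i y z \<bullet> partial_deriv j y z) *\<^sub>R axis i (axis j 1))"
    by (rule ext, simp add: vec_eq_iff first_form_nth forall_2 sum_2 axis_def)
  have "first_form y differentiable (at x)"
    unfolding eq by (intro differentiable_sum ballI differentiable_scaleR differentiable_inner assms) auto
  moreover have "bounded_linear (\<lambda>A::real^2^2. A $ i $ j)"
    by (rule bounded_linear_compose[OF bounded_linear_vec_nth bounded_linear_vec_nth])
  ultimately have "partial_deriv k (first_form y) x $ i $ j = partial_deriv k (\<lambda>z. first_form y z $ i $ j) x"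
    by (subst partial_deriv_bounded_linear[of "\<lambda>A. A $ i $ j"]) auto
  then show ?thesis
    by (simp add: first_form_nth partial_deriv_inner assms)
qed

text \<open>
  After the product rule, symmetry of second derivatives cancels the four terms that do not contain
  \<open>\<partial>\<^sub>i\<^sub>jy \<bullet> \<partial>\<^sub>my\<close>.
\<close>

lemma first_kind_christoffel:
  assumes "open S" "x \<in> S" "Ck_on 2 y S"
  defines "dg \<equiv> \<lambda>k. partial_deriv k (first_form y) x"
  shows "(dg i $ j $ m + dg j $ i $ m - dg m $ i $ j) / 2
    = partial_deriv i (partial_deriv j y) x \<bullet> partial_deriv m y x"
proof -
  note C = Ck_on_2D[OF assms(3)]
  have sym: "partial_deriv i (partial_deriv j y) x = partial_deriv j (partial_deriv i y) x" for i j
    by (rule partial_deriv_commute[OF assms(1,2)]) (use C in auto)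
  show ?thesis
    unfolding dg_def partial_deriv_first_form[OF C(2)[OF assms(2)]]
      sym[of j i] sym[of m i] sym[of m j]
    by (simp add: inner_commute)
qed

text \<open>
  Lagrange's identity. With it, invertibility of the metric says that the tangent vectors are
  linearly independent, so that the normal is defined.
\<close>

lemma norm_cross_partial_derivs:
  "(norm (cross3 (partial_deriv 1 y x) (partial_deriv 2 y x)))\<^sup>2 = det (first_form y x)"
  using norm_cross_dot[of "partial_deriv 1 y x" "partial_deriv 2 y x"]
  by (simp add: det_2 first_form_nth power_mult_distrib power2_norm_eq_inner)
    (simp add: inner_commute power2_eq_square)

lemma cross_partial_derivs_nonzero:
  assumes "invertible (first_form y x)"
  shows "cross3 (partial_deriv 1 y x) (partial_deriv 2 y x) \<noteq> 0"
  using norm_cross_partial_derivs[of y x] assms by (auto simp: invertible_det_nz)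

lemma uniformly_spd_on_invertible:
  assumes "uniformly_spd_on S g" "x \<in> S"
  shows "invertible (g x)"
proof -
  obtain c where c: "c > 0" "\<And>v. c * (v \<bullet> v) \<le> v \<bullet> (g x *v v)"
    using assms by (auto simp: uniformly_spd_on_def)
  have "v = 0" if "g x *v v = 0" for v
  proof -
    have "v \<bullet> v \<le> 0" using c(2)[of v] c(1) that by (simp add: mult_le_0_iff)
    then show ?thesis by (metis inner_gt_zero_iff not_le)
  qed
  then show ?thesis
    by (simp add: invertible_left_inverse matrix_left_invertible_ker)
qed

lemma unit_normal_differentiable:
  assumes "\<And>i. partial_deriv i y differentiable (at x)"
    and "cross3 (partial_deriv 1 y x) (partial_deriv 2 y x) \<noteq> 0"
  shows "unit_normal y differentiable (at x)"
proof -
  let ?n = "\<lambda>z. cross3 (partial_deriv 1 y z) (partial_deriv 2 y z)"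
  have bb: "bounded_bilinear cross3"
    using bilinear_cross bilinear_conv_bounded_bilinear by blast
  have n: "?n differentiable (at x)"
    using bounded_bilinear.FDERIV[OF bb has_derivative_frechet_derivative[OF assms(1)] has_derivative_frechet_derivative[OF assms(1)]]
    unfolding differentiable_def by blast
  have "(norm \<circ> ?n) differentiable (at x)"
    by (rule differentiable_chain_at[OF n differentiable_norm_at]) (use assms(2) in auto)
  then have "(\<lambda>z. inverse (norm (?n z)) *\<^sub>R ?n z) differentiable (at x)"
    using assms(2) n by (intro differentiable_scaleR differentiable_inverse) (auto simp: o_def)
  then show ?thesis by (simp add: unit_normal_def[abs_def] Let_def)
qed

lemma unit_normal_orthogonal: "unit_normal y x \<bullet> partial_deriv j y x = 0"
  using exhaust_2[of j] by (auto simp: unit_normal_def Let_def dot_cross_self)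

lemma unit_normal_unit:
  assumes "invertible (first_form y x)"
  shows "unit_normal y x \<bullet> unit_normal y x = 1"
  using cross_partial_derivs_nonzero[OF assms]
  by (simp add: unit_normal_def Let_def dot_square_norm power2_eq_square)

text \<open>
  Differentiating \<open>\<nu> \<bullet> \<partial>\<^sub>jy = 0\<close> in direction \<open>i\<close> moves the derivative from \<open>\<nu>\<close> to \<open>\<partial>\<^sub>jy\<close>.
\<close>

lemma second_form_eq:
  assumes "\<And>i. partial_deriv i y differentiable (at x)"
    and "cross3 (partial_deriv 1 y x) (partial_deriv 2 y x) \<noteq> 0"
  shows "second_form y x $ i $ j = partial_deriv i (partial_deriv j y) x \<bullet> unit_normal y x"
proof -
  have "partial_deriv i (\<lambda>z. unit_normal y z \<bullet> partial_deriv j y z) x = 0"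
    unfolding unit_normal_orthogonal by (rule partial_deriv_eqI[OF has_derivative_const])
  then show ?thesis
    unfolding partial_deriv_inner[OF unit_normal_differentiable[OF assms] assms(1)]
    by (simp add: second_form_nth inner_commute)
qed

text \<open>
  A vector \<open>w\<close> orthogonal to \<open>p\<close> and \<open>q\<close> has \<open>w \<times> (p \<times> q) = 0\<close> by the triple product
  expansion; if it is orthogonal to \<open>p \<times> q\<close> as well, then it vanishes.
\<close>

lemma eq_by_frame_components:
  assumes n: "cross3 (partial_deriv 1 y x) (partial_deriv 2 y x) \<noteq> 0"
    and tangential: "\<And>l. u \<bullet> partial_deriv l y x = v \<bullet> partial_deriv l y x"
    and normal: "u \<bullet> unit_normal y x = v \<bullet> unit_normal y x"
  shows "u = v"
proof -
  define p q where "p = partial_deriv 1 y x" and "q = partial_deriv 2 y x"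
  define w where "w = u - v"
  have w: "w \<bullet> p = 0" "w \<bullet> q = 0" "w \<bullet> cross3 p q = 0"
    using tangential normal n unfolding w_def p_def q_def
    by (simp_all add: inner_diff_left unit_normal_def Let_def)
  have "cross3 w (cross3 p q) = (w \<bullet> q) *\<^sub>R p - (w \<bullet> p) *\<^sub>R q"
    by (rule Lagrange)
  then have "w = 0"
    using norm_and_cross_eq_0[of w "cross3 p q"] w n by (simp add: p_def q_def)
  then show ?thesis by (simp add: w_def)
qed

lemma matrix_inv_mult_eq_iff:
  fixes A :: "'a::semiring_1^'n::finite^'n"
  assumes "invertible A"
  shows "matrix_inv A *v u = w \<longleftrightarrow> A *v w = u"
proof -
  have "A ** matrix_inv A = mat 1 \<and> matrix_inv A ** A = mat 1"
    using assms unfolding invertible_def matrix_inv_def by (rule someI_ex)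
  then have "A *v (matrix_inv A *v u) = u" "matrix_inv A *v (A *v w) = w"
    by (simp_all add: matrix_vector_mul_assoc)
  then show ?thesis by auto
qed

text \<open>
  Existence and uniqueness of the Gauss expansion at once. Comparing components along the frame
  \<open>\<partial>\<^sub>1y, \<partial>\<^sub>2y, \<nu>\<close>, the normal ones agree for every \<open>\<Gamma>\<close>, and the tangential ones say that
  \<open>g \<Gamma>\<^sub>i\<^sub>j\<close> has the entries \<open>\<partial>\<^sub>i\<^sub>jy \<bullet> \<partial>\<^sub>my\<close>: a linear system with invertible matrix
  whose right-hand side is known from \<open>\<partial>g\<close>.
\<close>

lemma gauss_formula_iff:
  assumes S: "open S" "x \<in> S" and C: "Ck_on 2 y S" and g: "invertible (first_form y x)"
  shows "(\<forall>i j. partial_deriv i (partial_deriv j y) x =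
       (\<Sum>l\<in>UNIV. \<Gamma> l i j *\<^sub>R partial_deriv l y x) + second_form y x $ i $ j *\<^sub>R unit_normal y x)
    \<longleftrightarrow> \<Gamma> = metric_christoffel (first_form y x) (\<lambda>k. partial_deriv k (first_form y) x)"
proof -
  let ?g = "first_form y x" and ?p = "\<lambda>i. partial_deriv i y x" and ?N = "unit_normal y x"
  let ?n = "cross3 (?p 1) (?p 2)"
  let ?H = "\<lambda>i j. partial_deriv i (partial_deriv j y) x"
  let ?M = "metric_christoffel ?g (\<lambda>k. partial_deriv k (first_form y) x)"
  note n = cross_partial_derivs_nonzero[OF g]
  note N1 = unit_normal_unit[OF g]
  have II: "second_form y x $ i $ j = ?H i j \<bullet> ?N" for i j
    by (rule second_form_eq[OF Ck_on_2D(2)[OF C S(2)] n])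
  have M: "?M = \<Gamma> \<longleftrightarrow> (\<forall>i j. ?g *v (\<chi> l. \<Gamma> l i j) = (\<chi> m. ?H i j \<bullet> ?p m))" for \<Gamma>
  proof -
    have "?M = \<Gamma> \<longleftrightarrow> (\<forall>i j. matrix_inv ?g *v (\<chi> m. ?H i j \<bullet> ?p m) = (\<chi> l. \<Gamma> l i j))"
      by (auto simp: fun_eq_iff metric_christoffel_def first_kind_christoffel[OF S C] vec_eq_iff)
    also have "\<dots> \<longleftrightarrow> (\<forall>i j. ?g *v (\<chi> l. \<Gamma> l i j) = (\<chi> m. ?H i j \<bullet> ?p m))"
      by (simp add: matrix_inv_mult_eq_iff[OF g])
    finally show ?thesis .
  qed
  have eq: "?H i j = (\<Sum>l\<in>UNIV. \<Gamma> l i j *\<^sub>R ?p l) + second_form y x $ i $ j *\<^sub>R ?N \<longleftrightarrow>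
     ?g *v (\<chi> l. \<Gamma> l i j) = (\<chi> m. ?H i j \<bullet> ?p m)" (is "_ = ?R \<longleftrightarrow> _") for i j
  proof -
    define R where "R = ?R"
    have tangential: "R \<bullet> ?p m = (?g *v (\<chi> l. \<Gamma> l i j)) $ m" for m
      by (simp add: R_def inner_add_left inner_sum_left unit_normal_orthogonal matrix_vector_mult_def
          first_form_nth inner_commute[of "?p m"] mult.commute)
    have normal: "R \<bullet> ?N = ?H i j \<bullet> ?N"
      using N1 by (simp add: R_def inner_add_left inner_sum_left II
          inner_commute[of "partial_deriv _ _ _" ?N] unit_normal_orthogonal)
    have "?H i j = R \<longleftrightarrow> (\<forall>m. R \<bullet> ?p m = ?H i j \<bullet> ?p m)"
      by (auto intro: eq_by_frame_components[OF n] simp: normal)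
    then show ?thesis
      unfolding R_def[symmetric] by (simp add: vec_eq_iff tangential)
  qed
  show ?thesis
    unfolding eq M[symmetric] by auto
qed

lemma
  assumes "open S" "x \<in> S" "Ck_on 2 y S" "invertible (first_form y x)"
  shows christoffel_eq_metric_christoffel:
      "christoffel y x = metric_christoffel (first_form y x) (\<lambda>k. partial_deriv k (first_form y) x)"
    and gauss_formula:
      "partial_deriv i (partial_deriv j y) x =
       (\<Sum>l\<in>UNIV. christoffel y x l i j *\<^sub>R partial_deriv l y x)
         + second_form y x $ i $ j *\<^sub>R unit_normal y x"
proof -
  show *: "christoffel y x = metric_christoffel (first_form y x) (\<lambda>k. partial_deriv k (first_form y) x)"
    unfolding christoffel_def gauss_formula_iff[OF assms] by simp
  show "partial_deriv i (partial_deriv j y) x =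
       (\<Sum>l\<in>UNIV. christoffel y x l i j *\<^sub>R partial_deriv l y x)
         + second_form y x $ i $ j *\<^sub>R unit_normal y x"
    using gauss_formula_iff[OF assms, of "christoffel y x"] * by blast
qed

section \<open>Tangential and normal parts of a tensor\<close>

text \<open>
  The squared norm of the tangential part \<open>\<Sum>\<^sub>l p\<^sub>l \<otimes> X\<^sub>l\<close>. Read from right to left, this exhibits the
  double sum, whose terms may have either sign, as a sum of squares.
\<close>

lemma sum_inner_self_gram:
  fixes p :: "'l::finite \<Rightarrow> real^'m::finite" and X :: "'l \<Rightarrow> 'b::real_inner"
  defines "T \<equiv> \<lambda>k. \<Sum>l\<in>UNIV. p l $ k *\<^sub>R X l"
  shows "(\<Sum>k\<in>UNIV. T k \<bullet> T k) = (\<Sum>l1\<in>UNIV. \<Sum>l2\<in>UNIV. (p l1 \<bullet> p l2) * (X l1 \<bullet> X l2))"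
proof -
  have "(\<Sum>k\<in>UNIV. T k \<bullet> T k)
      = (\<Sum>k\<in>UNIV. \<Sum>l1\<in>UNIV. \<Sum>l2\<in>UNIV. p l1 $ k * p l2 $ k * (X l1 \<bullet> X l2))"
    unfolding T_def inner_sum_left unfolding inner_sum_right
    by (intro sum.cong refl) (simp add: mult.left_commute)
  also have "\<dots> = (\<Sum>l1\<in>UNIV. \<Sum>k\<in>UNIV. \<Sum>l2\<in>UNIV. p l1 $ k * p l2 $ k * (X l1 \<bullet> X l2))"
    by (rule sum.swap)
  also have "\<dots> = (\<Sum>l1\<in>UNIV. \<Sum>l2\<in>UNIV. \<Sum>k\<in>UNIV. p l1 $ k * p l2 $ k * (X l1 \<bullet> X l2))"
    by (intro sum.cong[OF refl] sum.swap)
  finally show ?thesis by (simp add: inner_vec_def sum_distrib_right)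
qed

lemma gram_sum_nonneg:
  fixes p :: "'l::finite \<Rightarrow> real^'m::finite" and X :: "'l \<Rightarrow> 'b::real_inner"
  shows "0 \<le> (\<Sum>l1\<in>UNIV. \<Sum>l2\<in>UNIV. (p l1 \<bullet> p l2) * (X l1 \<bullet> X l2))"
  unfolding sum_inner_self_gram[symmetric] by (intro sum_nonneg inner_ge_zero)

text \<open>
  The norm of \<open>\<Sum>\<^sub>l p\<^sub>l \<otimes> X\<^sub>l + N \<otimes> Y\<close>. The type of \<open>X\<close> and \<open>Y\<close> is left open, because the first
  identity of the theorem needs matrices and the second one real numbers.
\<close>

lemma norm_tensor_pythagoras:
  fixes p :: "'l::finite \<Rightarrow> real^'m::finite" and N :: "real^'m"
    and X :: "'l \<Rightarrow> 'b::real_inner" and Y :: 'b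
  assumes "\<And>l. p l \<bullet> N = 0" "N \<bullet> N = 1"
  shows "(norm (\<chi> k. (\<Sum>l\<in>UNIV. p l $ k *\<^sub>R X l) + N $ k *\<^sub>R Y))\<^sup>2
    = (norm Y)\<^sup>2 + (\<Sum>l1\<in>UNIV. \<Sum>l2\<in>UNIV. (p l1 \<bullet> p l2) * (X l1 \<bullet> X l2))"
proof -
  define T where "T k = (\<Sum>l\<in>UNIV. p l $ k *\<^sub>R X l)" for k
  have "(\<Sum>k\<in>UNIV. N $ k * (T k \<bullet> Y)) = (\<Sum>k\<in>UNIV. \<Sum>l\<in>UNIV. p l $ k * N $ k * (X l \<bullet> Y))"
    by (simp add: T_def inner_sum_left sum_distrib_left mult.assoc mult.left_commute)
  also have "\<dots> = (\<Sum>l\<in>UNIV. \<Sum>k\<in>UNIV. p l $ k * N $ k * (X l \<bullet> Y))"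
    by (rule sum.swap)
  also have "\<dots> = (\<Sum>l\<in>UNIV. (p l \<bullet> N) * (X l \<bullet> Y))"
    by (simp add: inner_vec_def[of _ N] sum_distrib_right)
  finally have cross: "(\<Sum>k\<in>UNIV. N $ k * (T k \<bullet> Y)) = 0"
    using assms(1) by simp
  have "(norm (\<chi> k. T k + N $ k *\<^sub>R Y))\<^sup>2 = (\<Sum>k\<in>UNIV. (T k + N $ k *\<^sub>R Y) \<bullet> (T k + N $ k *\<^sub>R Y))"
    by (simp add: power2_norm_eq_inner inner_vec_def)
  also have "\<dots> = (\<Sum>k\<in>UNIV. T k \<bullet> T k + 2 * (N $ k * (T k \<bullet> Y)) + N $ k * N $ k * (Y \<bullet> Y))"
    by (intro sum.cong refl)
      (simp add: inner_add_left inner_add_right inner_commute[of Y "T _"] algebra_simps)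
  also have "\<dots> = (\<Sum>k\<in>UNIV. T k \<bullet> T k) + 2 * (\<Sum>k\<in>UNIV. N $ k * (T k \<bullet> Y)) + (N \<bullet> N) * (Y \<bullet> Y)"
    by (simp only: sum.distrib flip: sum_distrib_left sum_distrib_right)
      (simp add: inner_vec_def[of N])
  finally show ?thesis
    unfolding cross assms(2) by (simp add: T_def sum_inner_self_gram power2_norm_eq_inner)
qed

lemma matrix_conj_nth:
  fixes a G :: "real^'n::finite^'n"
  shows "(a ** G ** a) $ i $ j = (\<Sum>m\<in>UNIV. \<Sum>n\<in>UNIV. a $ i $ m * G $ m $ n * a $ n $ j)"
  unfolding matrix_matrix_mult_def by (subst sum.swap) (simp add: sum_distrib_right)

section \<open>The two intrinsic functions\<close>

text \<open>
  \<open>f\<^sub>1\<close> and \<open>f\<^sub>2\<close> are these expressions at \<open>\<Gamma> = christoffel y x\<close>. Leaving \<open>\<Gamma>\<close> open allows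
  inserting \<open>metric_christoffel\<close> instead, which exhibits them as functions of \<open>g\<close> and \<open>\<partial>g\<close>.
\<close>

definition tangential_hessian_energy :: "real^2^2 \<Rightarrow> (2 \<Rightarrow> 2 \<Rightarrow> 2 \<Rightarrow> real) \<Rightarrow> real"
  where "tangential_hessian_energy g \<Gamma> = (let a = inv_sqrt g in
    (\<Sum>i\<in>UNIV. \<Sum>j\<in>UNIV. \<Sum>l1\<in>UNIV. \<Sum>l2\<in>UNIV. g $ l1 $ l2 *
       (\<Sum>m1\<in>UNIV. \<Sum>m2\<in>UNIV. \<Sum>n1\<in>UNIV. \<Sum>n2\<in>UNIV.
          a $ i $ m1 * a $ i $ m2 * \<Gamma> l1 m1 n1 * \<Gamma> l2 m2 n2 * a $ n1 $ j * a $ n2 $ j)))"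

definition tangential_trace_energy :: "real^2^2 \<Rightarrow> (2 \<Rightarrow> 2 \<Rightarrow> 2 \<Rightarrow> real) \<Rightarrow> real"
  where "tangential_trace_energy g \<Gamma> = (let a = inv_sqrt g in
    (\<Sum>l1\<in>UNIV. \<Sum>l2\<in>UNIV. g $ l1 $ l2 *
       (\<Sum>i1\<in>UNIV. \<Sum>i2\<in>UNIV. \<Sum>m1\<in>UNIV. \<Sum>m2\<in>UNIV. \<Sum>n1\<in>UNIV. \<Sum>n2\<in>UNIV.
          a $ i1 $ m1 * a $ i2 $ m2 * \<Gamma> l1 m1 n1 * \<Gamma> l2 m2 n2 * a $ n1 $ i1 * a $ n2 $ i2)))"

lemma matrix_conj_nth_product:
  fixes a G H :: "real^'n::finite^'n"
  shows "(a ** G ** a) $ i $ j * (a ** H ** a) $ k $ l =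
    (\<Sum>m1\<in>UNIV. \<Sum>m2\<in>UNIV. \<Sum>n1\<in>UNIV. \<Sum>n2\<in>UNIV.
      a $ i $ m1 * a $ k $ m2 * G $ m1 $ n1 * H $ m2 $ n2 * a $ n1 $ j * a $ n2 $ l)"
  unfolding matrix_conj_nth sum_product by (intro sum.cong refl) (simp add: mult.commute mult.left_commute)

lemma tangential_hessian_energy_gram:
  "tangential_hessian_energy g \<Gamma> = (\<Sum>l1\<in>UNIV. \<Sum>l2\<in>UNIV. g $ l1 $ l2 *
     ((inv_sqrt g ** (\<chi> i j. \<Gamma> l1 i j) ** inv_sqrt g) \<bullet> (inv_sqrt g ** (\<chi> i j. \<Gamma> l2 i j) ** inv_sqrt g)))"
proof -
  define X where "X l = inv_sqrt g ** (\<chi> i j. \<Gamma> l i j) ** inv_sqrt g" for l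
  have "tangential_hessian_energy g \<Gamma> = (\<Sum>i\<in>UNIV. \<Sum>j\<in>UNIV. \<Sum>l1\<in>UNIV. \<Sum>l2\<in>UNIV. g $ l1 $ l2 *
     (X l1 $ i $ j * X l2 $ i $ j))"
    unfolding X_def matrix_conj_nth_product by (simp add: tangential_hessian_energy_def Let_def)
  also have "\<dots> = (\<Sum>l1\<in>UNIV. \<Sum>l2\<in>UNIV. g $ l1 $ l2 * (X l1 \<bullet> X l2))"
    by (simp add: inner_vec_def sum_2 algebra_simps)
  finally show ?thesis unfolding X_def .
qed

lemma tangential_trace_energy_gram:
  "tangential_trace_energy g \<Gamma> = (\<Sum>l1\<in>UNIV. \<Sum>l2\<in>UNIV. g $ l1 $ l2 *
     (trace (inv_sqrt g ** (\<chi> i j. \<Gamma> l1 i j) ** inv_sqrt g) \<bullet>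
      trace (inv_sqrt g ** (\<chi> i j. \<Gamma> l2 i j) ** inv_sqrt g)))"
proof -
  have "trace (a ** G ** a) \<bullet> trace (a ** H ** a) =
    (\<Sum>i1\<in>UNIV. \<Sum>i2\<in>UNIV. \<Sum>m1\<in>UNIV. \<Sum>m2\<in>UNIV. \<Sum>n1\<in>UNIV. \<Sum>n2\<in>UNIV.
      a $ i1 $ m1 * a $ i2 $ m2 * G $ m1 $ n1 * H $ m2 $ n2 * a $ n1 $ i1 * a $ n2 $ i2)"
    for a G H :: "real^2^2"
    unfolding matrix_conj_nth_product[symmetric] by (simp add: trace_def sum_product)
  then show ?thesis by (simp add: tangential_trace_energy_def Let_def)
qed

lemma linear_matrix_conj: "linear (\<lambda>A :: real^'n::finite^'n. a ** A ** a)"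
  by (rule linearI)
    (simp_all add: vec_eq_iff matrix_conj_nth sum.distrib sum_distrib_left algebra_simps)

lemma tensor_conj_sum:
  fixes a B :: "real^'n::finite^'n"
  assumes "\<And>k i j. T $ k $ i $ j = (\<Sum>l\<in>UNIV. \<Gamma> l i j * p l $ k) + B $ i $ j * N $ k"
  shows "tensor_conj a T =
    (\<chi> k. (\<Sum>l\<in>UNIV. p l $ k *\<^sub>R (a ** (\<chi> i j. \<Gamma> l i j) ** a)) + N $ k *\<^sub>R (a ** B ** a))"
proof -
  have "T $ k = (\<Sum>l\<in>UNIV. p l $ k *\<^sub>R (\<chi> i j. \<Gamma> l i j)) + N $ k *\<^sub>R B" for k
    by (simp add: vec_eq_iff assms mult.commute)
  then show ?thesis
    unfolding tensor_conj_def
    by (simp add: linear_add[OF linear_matrix_conj] linear_sum[OF linear_matrix_conj]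
        linear_scale[OF linear_matrix_conj])
qed

lemma linear_trace: "linear (trace :: real^'n::finite^'n \<Rightarrow> real)"
  by (rule linearI) (simp_all add: trace_def sum.distrib sum_distrib_left)

text \<open>
  At each point the Gauss formula puts the conjugated Hessian tensor and its trace into the form to
  which Pythagoras applies.
\<close>

lemma energy_splitting:
  assumes S: "open S" "x \<in> S" and C: "Ck_on 2 y S" and spd: "uniformly_spd_on S (first_form y)"
  defines "g \<equiv> first_form y x" and "\<Gamma> \<equiv> christoffel y x" and "a \<equiv> inv_sqrt (first_form y x)"
    and "T \<equiv> tensor_conj (inv_sqrt (first_form y x)) (hessian_tensor y x)" and "II \<equiv> second_form y x"
  shows "0 \<le> tangential_hessian_energy g \<Gamma>" "0 \<le> tangential_trace_energy g \<Gamma>"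
    "(norm T)\<^sup>2 = (norm (a ** II ** a))\<^sup>2 + tangential_hessian_energy g \<Gamma>"
    "(norm (tensor_trace T))\<^sup>2 = (trace (a ** II ** a))\<^sup>2 + tangential_trace_energy g \<Gamma>"
proof -
  note inv = uniformly_spd_on_invertible[OF spd S(2)]
  define p N where "p = (\<lambda>l. partial_deriv l y x)" and "N = unit_normal y x"
  \<comment> \<open>\<open>X l\<close> is the coefficient matrix of \<open>\<partial>\<^sub>ly\<close> in the conjugated Hessian tensor.\<close>
  define X where "X l = a ** (\<chi> i j. \<Gamma> l i j) ** a" for l
  have gram: "g $ l1 $ l2 = p l1 \<bullet> p l2" for l1 l2
    by (simp add: g_def p_def first_form_nth)
  have E1: "tangential_hessian_energy g \<Gamma> = (\<Sum>l1\<in>UNIV. \<Sum>l2\<in>UNIV. (p l1 \<bullet> p l2) * (X l1 \<bullet> X l2))"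
    unfolding tangential_hessian_energy_gram X_def by (simp add: a_def gram flip: g_def)
  have E2: "tangential_trace_energy g \<Gamma>
      = (\<Sum>l1\<in>UNIV. \<Sum>l2\<in>UNIV. (p l1 \<bullet> p l2) * (trace (X l1) \<bullet> trace (X l2)))"
    unfolding tangential_trace_energy_gram X_def by (simp add: a_def gram flip: g_def)
  have N: "p l \<bullet> N = 0" "N \<bullet> N = 1" for l
    using unit_normal_orthogonal[of y x l] unit_normal_unit[OF inv]
    by (simp_all add: p_def N_def inner_commute)
  have T: "T = (\<chi> k. (\<Sum>l\<in>UNIV. p l $ k *\<^sub>R X l) + N $ k *\<^sub>R (a ** II ** a))"
    unfolding T_def X_def a_def
    by (rule tensor_conj_sum)
      (simp add: hessian_tensor_nth[OF S C] gauss_formula[OF S C inv] \<Gamma>_def p_def II_def N_def)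
  have tr: "tensor_trace T
      = (\<chi> k. (\<Sum>l\<in>UNIV. p l $ k *\<^sub>R trace (X l)) + N $ k *\<^sub>R trace (a ** II ** a))"
    unfolding T tensor_trace_def
    by (simp add: linear_add[OF linear_trace] linear_sum[OF linear_trace] linear_scale[OF linear_trace])
  show "(norm T)\<^sup>2 = (norm (a ** II ** a))\<^sup>2 + tangential_hessian_energy g \<Gamma>"
    unfolding T E1 by (rule norm_tensor_pythagoras[OF N])
  show "(norm (tensor_trace T))\<^sup>2 = (trace (a ** II ** a))\<^sup>2 + tangential_trace_energy g \<Gamma>"
    unfolding tr E2 by (subst norm_tensor_pythagoras[OF N]) simp
  show "0 \<le> tangential_hessian_energy g \<Gamma>" "0 \<le> tangential_trace_energy g \<Gamma>"
    unfolding E1 E2 by (rule gram_sum_nonneg)+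
qed

theorem proposition1:
  shows "\<exists>F1 F2 :: real^2^2 \<Rightarrow> (2 \<Rightarrow> real^2^2) \<Rightarrow> real.
    \<forall>(\<Omega> :: (real^2) set) (y :: real^2 \<Rightarrow> real^3).
      open \<Omega> \<longrightarrow> Ck_on 2 y \<Omega> \<longrightarrow> uniformly_spd_on \<Omega> (first_form y) \<longrightarrow>
      (\<exists>f1 f2 :: real^2 \<Rightarrow> real. \<forall>x\<in>\<Omega>.
         (let g = first_form y x; dg = (\<lambda>k. partial_deriv k (first_form y) x);
              II = second_form y x; a = inv_sqrt g; \<Gamma> = christoffel y x
          in 0 \<le> f1 x \<and> 0 \<le> f2 x \<and>
             f1 x = F1 g dg \<and> f2 x = F2 g dg \<and>
             (norm (tensor_conj a (hessian_tensor y x)))\<^sup>2 = (norm (a ** II ** a))\<^sup>2 + f1 x \<and>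
             (norm (tensor_trace (tensor_conj a (hessian_tensor y x))))\<^sup>2
               = (trace (a ** II ** a))\<^sup>2 + f2 x \<and>
             f1 x = (\<Sum>i\<in>UNIV. \<Sum>j\<in>UNIV. \<Sum>l1\<in>UNIV. \<Sum>l2\<in>UNIV. g $ l1 $ l2 *
               (\<Sum>m1\<in>UNIV. \<Sum>m2\<in>UNIV. \<Sum>n1\<in>UNIV. \<Sum>n2\<in>UNIV.
                  a $ i $ m1 * a $ i $ m2 * \<Gamma> l1 m1 n1 * \<Gamma> l2 m2 n2 * a $ n1 $ j * a $ n2 $ j)) \<and>
             f2 x = (\<Sum>l1\<in>UNIV. \<Sum>l2\<in>UNIV. g $ l1 $ l2 *
               (\<Sum>i1\<in>UNIV. \<Sum>i2\<in>UNIV. \<Sum>m1\<in>UNIV. \<Sum>m2\<in>UNIV. \<Sum>n1\<in>UNIV. \<Sum>n2\<in>UNIV.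
                  a $ i1 $ m1 * a $ i2 $ m2 * \<Gamma> l1 m1 n1 * \<Gamma> l2 m2 n2 * a $ n1 $ i1 * a $ n2 $ i2))))"
proof -
  let ?f1 = "\<lambda>y x. tangential_hessian_energy (first_form y x) (christoffel y x)"
    and ?f2 = "\<lambda>y x. tangential_trace_energy (first_form y x) (christoffel y x)"
    and ?\<Gamma> = "\<lambda>y x. metric_christoffel (first_form y x) (\<lambda>k. partial_deriv k (first_form y) x)"
  have intrinsic: "?f1 y x = tangential_hessian_energy (first_form y x) (?\<Gamma> y x)"
      "?f2 y x = tangential_trace_energy (first_form y x) (?\<Gamma> y x)"
    if "open \<Omega>" "x \<in> \<Omega>" "Ck_on 2 y \<Omega>" "uniformly_spd_on \<Omega> (first_form y)" for \<Omega> y x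
    using christoffel_eq_metric_christoffel[OF that(1-3) uniformly_spd_on_invertible[OF that(4,2)]]
    by simp_all
  show ?thesis
    unfolding Let_def
    by (rule exI[of _ "\<lambda>g dg. tangential_hessian_energy g (metric_christoffel g dg)"],
        rule exI[of _ "\<lambda>g dg. tangential_trace_energy g (metric_christoffel g dg)"],
        intro allI impI, rule_tac x = "?f1 y" in exI, rule_tac x = "?f2 y" in exI, intro ballI conjI)
      (rule energy_splitting intrinsic tangential_hessian_energy_def[unfolded Let_def]
        tangential_trace_energy_def[unfolded Let_def]; assumption)+
qed

end
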